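(* Let $p$ be a univariate real polynomial of degree at most $n_p$ that is monotonic (i.e. non-decreasing or non-increasing) on a finite interval $[t_a, t_b]$, $t_a < t_b$. Then there exists a finite partition $t_a = s_0 < s_1 < \dots < s_N = t_b$ of $[t_a,t_b]$ such that, for every $i \in \{1,\dots,N\}$, $p$ is tightly bounded by its Bernstein coefficients (of degree $n_p$) on the sub-interval $[s_{i-1}, s_i]$.
   Context: Bernstein coefficients on $[0,1]$: for a polynomial $q$ of degree at most $n_p$, the Bernstein coefficients $\{\beta_j\}_{j=0}^{n_p}$ of $q$ are the unique real numbers such that $q(t) = \sum_{j=0}^{n_p} \beta_j b_{n_p,j}(t)$, where $b_{n_p,j}(t) := \binom{n_p}{j} t^j (1-t)^{n_p-j}$. Equivalently, if $q(t) = \sum_{k=0}^{n_p} \alpha_k t^k$, then $\beta_j = \sum_{k=0}^{j} \alpha_k \binom{j}{k} / \binom{n_p}{k}$. Bernstein coefficients on a sub-interval: for $s < e$, the Bernstein coefficients of $p$ on $[s,e]$ are the Bernstein coefficients (with the same $n_p$) of the rescaled polynomial $q(\tau) := p(s + (e-s)\tau)$, $\tau \in [0,1]$. Tightly bounded: $p$ is tightly bounded by its Bernstein coefficients $\{\beta_j\}_{j=0}^{n_p}$ on $[s,e]$ if $\min_{0 \le j \le n_p} \beta_j = \min_{t \in [s,e]} p(t)$ and $\max_{0 \le j \le n_p} \beta_j = \max_{t \in [s,e]} p(t)$. (In general one only has $\min_j \beta_j \le \min_{[s,e]} p$ and $\max_j \beta_j \ge \max_{[s,e]} p$.) *)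

theory Defs
  imports "HOL-Analysis.Analysis" "HOL-Computational_Algebra.Polynomial"
begin

text \<open>\<^term>\<open>Bernstein n j t\<close> is the library's Bernstein basis polynomial
  \<open>(n choose j) * t ^ j * (1 - t) ^ (n - j)\<close>.\<close>

text \<open>The coefficients are indexed by \<open>{..n}\<close>; the value \<open>0\<close> beyond \<open>n\<close> only serves to make
  the sequence unique as a total function.\<close>

definition is_bernstein_coeffs :: "nat \<Rightarrow> real poly \<Rightarrow> (nat \<Rightarrow> real) \<Rightarrow> bool" where
  "is_bernstein_coeffs n q \<beta> \<longleftrightarrow>
     (\<forall>t. poly q t = (\<Sum>j\<le>n. \<beta> j * Bernstein n j t)) \<and> (\<forall>j>n. \<beta> j = 0)"

definition bernstein_coeff :: "nat \<Rightarrow> real poly \<Rightarrow> nat \<Rightarrow> real" where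
  "bernstein_coeff n q = (THE \<beta>. is_bernstein_coeffs n q \<beta>)"

lemma is_bernstein_coeffs_explicit:
  fixes q :: "real poly"
  assumes "degree q \<le> n"
  shows "is_bernstein_coeffs n q
    (\<lambda>j. if j \<le> n then \<Sum>k\<le>j. coeff q k * real (j choose k) / real (n choose k) else 0)"
proof -
  have basis: "(\<Sum>j\<le>n. real (j choose k) / real (n choose k) * Bernstein n j t) = t ^ k"
    if "k \<le> n" for k and t :: real
  proof -
    have "(\<Sum>j\<le>n. real (j choose k) / real (n choose k) * Bernstein n j t)
        = (\<Sum>j\<in>{k..n}. real (j choose k) / real (n choose k) * Bernstein n j t)"
      by (rule sum.mono_neutral_right) auto
    also have "\<dots> = (\<Sum>j\<in>{k..n}. t ^ k * Bernstein (n - k) (j - k) t)"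
    proof (rule sum.cong[OF refl])
      fix j assume j: "j \<in> {k..n}"
      have "real (n choose j) * real (j choose k) = real (n choose k) * real ((n - k) choose (j - k))"
        using choose_mult[of k j n] j by (metis atLeastAtMost_iff of_nat_mult)
      moreover have "real (n choose k) \<noteq> 0"
        using that by simp
      ultimately have c: "real (j choose k) / real (n choose k) * real (n choose j)
          = real ((n - k) choose (j - k))"
        by (simp add: field_simps)
      have t: "t ^ j = t ^ k * t ^ (j - k)" and e: "n - k - (j - k) = n - j"
        using j by (simp_all only: atLeastAtMost_iff power_add[symmetric]) auto
      have "real (j choose k) / real (n choose k) * Bernstein n j t
          = (real (j choose k) / real (n choose k) * real (n choose j)) * t ^ j * (1 - t) ^ (n - j)"
        by (simp add: Bernstein_def)
      then show "real (j choose k) / real (n choose k) * Bernstein n j t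
          = t ^ k * Bernstein (n - k) (j - k) t"
        unfolding c by (simp only: Bernstein_def t e ac_simps)
    qed
    also have "\<dots> = t ^ k * (\<Sum>i\<le>n - k. Bernstein (n - k) i t)"
      unfolding sum_distrib_left
      by (rule sum.reindex_bij_witness[of _ "\<lambda>i. i + k" "\<lambda>j. j - k"]) (use that in auto)
    finally show ?thesis by simp
  qed
  have "poly q t = (\<Sum>j\<le>n. (\<Sum>k\<le>j. coeff q k * real (j choose k) / real (n choose k)) * Bernstein n j t)"
    for t
  proof -
    have "poly q t = (\<Sum>k\<le>n. coeff q k * t ^ k)"
      unfolding poly_altdef
      by (rule sum.mono_neutral_left) (use assms in \<open>auto simp: coeff_eq_0\<close>)
    also have "\<dots> = (\<Sum>k\<le>n. \<Sum>j\<le>n. coeff q k * (real (j choose k) / real (n choose k) * Bernstein n j t))"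
      using basis by (intro sum.cong refl) (simp only: sum_distrib_left[symmetric] atMost_iff)
    also have "\<dots> = (\<Sum>j\<le>n. \<Sum>k\<le>n. coeff q k * real (j choose k) / real (n choose k) * Bernstein n j t)"
      by (subst sum.swap) (simp add: mult.assoc)
    also have "\<dots> = (\<Sum>j\<le>n. \<Sum>k\<le>j. coeff q k * real (j choose k) / real (n choose k) * Bernstein n j t)"
      by (intro sum.cong refl sum.mono_neutral_right) auto
    finally show ?thesis
      by (simp add: sum_distrib_right)
  qed
  then show ?thesis
    by (simp add: is_bernstein_coeffs_def)
qed

lemma is_bernstein_coeffs_unique:
  assumes "is_bernstein_coeffs n q \<beta>" "is_bernstein_coeffs n q \<gamma>"
  shows "\<beta> = \<gamma>"
proof (rule ccontr)
  assume "\<beta> \<noteq> \<gamma>"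
  then obtain k where k: "\<beta> k \<noteq> \<gamma> k" by auto
  then have kn: "k \<le> n"
    using assms by (metis is_bernstein_coeffs_def not_le)
  define c where "c = (\<lambda>j. (\<beta> j - \<gamma> j) * real (n choose j))"
  have root: "(\<Sum>j\<le>n. c j * x ^ j) = 0" if "x > 0" for x
  proof -
    define t where "t = x / (1 + x)"
    have x1: "1 - t = 1 / (1 + x)" using that by (simp add: t_def field_simps)
    have "(\<Sum>j\<le>n. c j * x ^ j) = (\<Sum>j\<le>n. (1 + x) ^ n * ((\<beta> j - \<gamma> j) * Bernstein n j t))"
    proof (rule sum.cong[OF refl])
      fix j assume "j \<in> {..n}"
      then have "(1 + x) ^ n = (1 + x) ^ j * (1 + x) ^ (n - j)"
        by (simp only: atMost_iff power_add[symmetric]) simp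
      then show "c j * x ^ j = (1 + x) ^ n * ((\<beta> j - \<gamma> j) * Bernstein n j t)"
        unfolding Bernstein_def x1 c_def using that by (simp add: t_def power_divide)
    qed
    also have "\<dots> = (1 + x) ^ n * ((\<Sum>j\<le>n. \<beta> j * Bernstein n j t) - (\<Sum>j\<le>n. \<gamma> j * Bernstein n j t))"
      by (simp add: sum_distrib_left sum_subtractf algebra_simps)
    also have "\<dots> = 0"
      using assms by (simp add: is_bernstein_coeffs_def)
    finally show ?thesis .
  qed
  have "c k \<noteq> 0" using k kn by (simp add: c_def)
  then have "finite {x. (\<Sum>j\<le>n. c j * x ^ j) = 0}"
    using polyfun_finite_roots[of c n] kn by blast
  then have "finite {0::real<..}"
    by (rule finite_subset[rotated]) (use root in auto)
  then show False
    by (simp add: infinite_Ioi)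
qed

lemma bernstein_coeff_works:
  "degree q \<le> n \<Longrightarrow> is_bernstein_coeffs n q (bernstein_coeff n q)"
  unfolding bernstein_coeff_def
  by (rule theI[where P = "is_bernstein_coeffs n q", OF is_bernstein_coeffs_explicit])
    (auto intro: is_bernstein_coeffs_unique is_bernstein_coeffs_explicit)

definition bernstein_coeff_on :: "nat \<Rightarrow> real poly \<Rightarrow> real \<Rightarrow> real \<Rightarrow> nat \<Rightarrow> real" where
  "bernstein_coeff_on n p s e = bernstein_coeff n (pcompose p [:s, e - s:])"

text \<open>\<open>LEAST\<close> and \<open>GREATEST\<close> are the attained minimum and maximum of \<open>p\<close> on the compact
  interval; \<^const>\<open>Min\<close> and \<^const>\<open>Max\<close> are meaningful only for finite sets.\<close>

definition tightly_bounded :: "nat \<Rightarrow> real poly \<Rightarrow> real \<Rightarrow> real \<Rightarrow> bool" where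
  "tightly_bounded n p s e \<longleftrightarrow>
     Min (bernstein_coeff_on n p s e ` {..n}) = (LEAST y. y \<in> poly p ` {s..e}) \<and>
     Max (bernstein_coeff_on n p s e ` {..n}) = (GREATEST y. y \<in> poly p ` {s..e})"

end

theory Submission
  imports Defs
begin

text \<open>
  The first and the last Bernstein coefficient of \<open>p\<close> on \<open>[s, e]\<close> are the end values
  \<open>p s\<close> and \<open>p e\<close>, and \<open>p\<close> takes only convex combinations of its coefficients. Hence the
  coefficients are tight as soon as all of them lie between \<open>p s\<close> and \<open>p e\<close>; call such an
  interval good.

  Short intervals with a prescribed endpoint \<open>c\<close> are good. For constant \<open>p\<close> all
  coefficients agree. Otherwise write
  \<open>p (c + h) = a\<^sub>0 + a\<^sub>m h\<^sup>m + \<dots>\<close> with \<open>m \<ge> 1\<close> and \<open>a\<^sub>m \<noteq> 0\<close>. The \<open>j\<close>-th coefficient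
  on the interval from \<open>c\<close> to \<open>c + h\<close> equals \<open>a\<^sub>0\<close> if \<open>j < m\<close>, and otherwise it is
  \<open>a\<^sub>0 + w a\<^sub>m h\<^sup>m + O(h\<^sup>m\<^sup>+\<^sup>1)\<close> with \<open>w = (j choose m) / (n choose m)\<close>. For
  \<open>m \<le> j < n\<close> this \<open>w\<close> is strictly between 0 and 1, so for small \<open>h\<close> the coefficient lies
  between \<open>a\<^sub>0 = p c\<close> and \<open>p (c + h)\<close>. Nothing depends on the sign of \<open>h\<close>, and exchanging the
  endpoints of an interval only reverses the list of coefficients, so intervals to the left of
  \<open>c\<close> are covered as well.

  A partition into good intervals then exists by compactness, here in the form of Bolzano's
  bisection principle: an interval that is shorter than the bound at one of its points \<open>x\<close>
  is cut at \<open>x\<close> into at most two good pieces.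
\<close>

section \<open>Bernstein coefficients on an interval\<close>

lemma is_bernstein_coeffs_on:
  assumes "degree p \<le> n"
  shows "is_bernstein_coeffs n (pcompose p [:s, e - s:]) (bernstein_coeff_on n p s e)"
proof -
  have "degree (pcompose p [:s, e - s:]) \<le> n"
    using degree_pcompose_le[of p "[:s, e - s:]"] assms
    by (cases "e = s") auto
  then show ?thesis
    unfolding bernstein_coeff_on_def by (rule bernstein_coeff_works)
qed

lemma bernstein_coeff_eqI:
  assumes "is_bernstein_coeffs n q \<beta>"
  shows "bernstein_coeff n q = \<beta>"
  unfolding bernstein_coeff_def
  using assms is_bernstein_coeffs_unique by (intro the_equality) auto

lemma bernstein_coeff_on_eq_taylor_sum:
  fixes p :: "real poly"
  assumes "degree p \<le> n" and "j \<le> n"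
  shows "bernstein_coeff_on n p c (c + h) j =
    (\<Sum>k\<le>j. coeff (pcompose p [:c, 1:]) k * (real (j choose k) / real (n choose k)) * h ^ k)"
proof -
  have q: "pcompose p [:c, h:] = pcompose (pcompose p [:c, 1:]) [:0, h:]"
    by (simp add: pcompose_assoc[symmetric] pcompose_pCons)
  have "degree (pcompose p [:c, h:]) \<le> n"
    using degree_pcompose_le[of p "[:c, h:]"] assms(1) by (cases "h = 0") auto
  then show ?thesis
    unfolding bernstein_coeff_on_def
    using assms(2) bernstein_coeff_eqI[OF is_bernstein_coeffs_explicit]
    by (simp add: q coeff_pcompose_linear mult_ac)
qed

lemma bernstein_coeff_on_first:
  assumes "degree p \<le> n"
  shows "bernstein_coeff_on n p s e 0 = poly p s"
proof -
  have "bernstein_coeff_on n p s e 0 = coeff (pcompose p [:s, 1:]) 0"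
    using bernstein_coeff_on_eq_taylor_sum[OF assms, of 0 s "e - s"] by simp
  then show ?thesis
    by (simp add: coeff_pcompose_0)
qed

text \<open>The reflection \<open>t \<mapsto> 1 - t\<close> permutes the Bernstein basis.\<close>

lemma bernstein_coeff_on_swap:
  assumes "degree p \<le> n" and "j \<le> n"
  shows "bernstein_coeff_on n p e s j = bernstein_coeff_on n p s e (n - j)"
proof -
  let ?\<beta> = "bernstein_coeff_on n p s e"
  have "poly (pcompose p [:e, s - e:]) t = (\<Sum>j\<le>n. ?\<beta> (n - j) * Bernstein n j t)" for t
  proof -
    have "poly (pcompose p [:e, s - e:]) t = poly (pcompose p [:s, e - s:]) (1 - t)"
      by (simp add: poly_pcompose algebra_simps)
    also have "\<dots> = (\<Sum>j\<le>n. ?\<beta> j * Bernstein n j (1 - t))"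
      using is_bernstein_coeffs_on[OF assms(1)] unfolding is_bernstein_coeffs_def by blast
    also have "\<dots> = (\<Sum>j\<le>n. ?\<beta> (n - j) * Bernstein n (n - j) (1 - t))"
      by (rule sum.reindex_bij_witness[of _ "\<lambda>j. n - j" "\<lambda>j. n - j"]) auto
    also have "\<dots> = (\<Sum>j\<le>n. ?\<beta> (n - j) * Bernstein n j t)"
      by (intro sum.cong refl) (simp add: Bernstein_def binomial_symmetric[symmetric])
    finally show ?thesis .
  qed
  then have "is_bernstein_coeffs n (pcompose p [:e, s - e:])
      (\<lambda>j. if j \<le> n then ?\<beta> (n - j) else 0)"
    unfolding is_bernstein_coeffs_def by simp
  from bernstein_coeff_eqI[OF this] show ?thesis
    using assms(2) by (simp add: bernstein_coeff_on_def)
qed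

lemma bernstein_coeff_on_last:
  assumes "degree p \<le> n"
  shows "bernstein_coeff_on n p s e n = poly p e"
  using bernstein_coeff_on_swap[OF assms, of n s e] bernstein_coeff_on_first[OF assms] by simp

text \<open>On \<open>[0, 1]\<close> the Bernstein basis is nonnegative and sums to 1, so every value of the
  polynomial is a convex combination of its coefficients.\<close>

lemma poly_in_convex_of_bernstein_coeff_on:
  assumes "degree p \<le> n" and "s < e" and "t \<in> {s..e}"
    and "convex C" and "\<And>j. j \<le> n \<Longrightarrow> bernstein_coeff_on n p s e j \<in> C"
  shows "poly p t \<in> C"
proof -
  define u where "u = (t - s) / (e - s)"
  have u: "0 \<le> u" "u \<le> 1" "s + (e - s) * u = t"
    using assms(2,3) by (auto simp: u_def field_simps)
  have "poly p t = poly (pcompose p [:s, e - s:]) u"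
    using u(3) by (simp add: poly_pcompose mult.commute)
  also have "\<dots> = (\<Sum>j\<le>n. Bernstein n j u *\<^sub>R bernstein_coeff_on n p s e j)"
    using is_bernstein_coeffs_on[OF assms(1)]
    unfolding is_bernstein_coeffs_def by (simp add: mult.commute)
  also have "\<dots> \<in> C"
    using assms(4,5) u(1,2) by (intro convex_sum) (auto intro: Bernstein_nonneg)
  finally show ?thesis .
qed

lemma tightly_bounded_if_coeffs_between_end_values:
  assumes "degree p \<le> n" and "s < e"
    and between: "\<And>j. j \<le> n \<Longrightarrow>
      bernstein_coeff_on n p s e j \<in> closed_segment (poly p s) (poly p e)"
  shows "tightly_bounded n p s e"
proof -
  let ?B = "bernstein_coeff_on n p s e ` {..n}"
  let ?P = "poly p ` {s..e}"
  define l u where "l = min (poly p s) (poly p e)" and "u = max (poly p s) (poly p e)"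
  have seg: "closed_segment (poly p s) (poly p e) = {l..u}"
    by (auto simp: closed_segment_eq_real_ivl l_def u_def)
  have B: "?B \<subseteq> {l..u}"
    using between seg by auto
  have P: "?P \<subseteq> {l..u}"
    using poly_in_convex_of_bernstein_coeff_on[OF assms(1,2) _ convex_closed_segment between] seg
    by auto
  have "poly p s \<in> ?B" "poly p e \<in> ?B"
    using bernstein_coeff_on_first[OF assms(1), of s e] bernstein_coeff_on_last[OF assms(1), of s e]
    by (metis atMost_iff imageI le0, metis atMost_iff imageI order_refl)
  then have B': "l \<in> ?B" "u \<in> ?B"
    by (auto simp: l_def u_def min_def max_def)
  have P': "l \<in> ?P" "u \<in> ?P"
    using assms(2) by (auto simp: l_def u_def min_def max_def)
  have "Min ?B = l" "Max ?B = u"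
    using B B' by (auto intro!: Min_eqI Max_eqI)
  moreover have "(LEAST y. y \<in> ?P) = l" "(GREATEST y. y \<in> ?P) = u"
    using P P' by (auto intro!: Least_equality Greatest_equality)
  ultimately show ?thesis
    unfolding tightly_bounded_def by simp
qed

section \<open>Coefficients on short intervals\<close>

lemma binomial_ratio_strictly_between:
  fixes j k n :: nat
  assumes "0 < k" and "k \<le> j" and "j < n"
  shows "0 < real (j choose k) / real (n choose k)" "real (j choose k) / real (n choose k) < 1"
proof -
  have "(j choose k) < (Suc j choose k)"
    using assms by (cases k) auto
  also have "\<dots> \<le> (n choose k)"
    using assms by (intro binomial_right_mono) auto
  finally show "real (j choose k) / real (n choose k) < 1"
    by (simp add: divide_less_eq)
  show "0 < real (j choose k) / real (n choose k)"
    using assms by simp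
qed

text \<open>A polynomial \<open>B\<close> in \<open>h\<close> arises from \<open>A = a\<^sub>0 + a\<^sub>m h\<^sup>m + \<dots>\<close> by truncation and by
  shrinking each nonconstant term with a factor strictly between 0 and 1. Either only \<open>a\<^sub>0\<close>
  survives the truncation, or near \<open>h = 0\<close> the terms of order \<open>m\<close> decide; in both cases \<open>B\<close> lies between \<open>a\<^sub>0\<close> and \<open>A\<close>.\<close>

lemma eventually_shrunk_truncation_between:
  fixes a w :: "nat \<Rightarrow> real"
  assumes "j \<le> n" and "w 0 = 1" and w: "\<And>k. 0 < k \<Longrightarrow> k \<le> j \<Longrightarrow> 0 < w k \<and> w k < 1"
  shows "\<forall>\<^sub>F h in nhds 0.
    (\<Sum>k\<le>j. a k * w k * h ^ k) \<in> closed_segment (a 0) (\<Sum>k\<le>n. a k * h ^ k)"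
proof (cases "\<exists>m. 0 < m \<and> m \<le> j \<and> a m \<noteq> 0")
  case False
  have "(\<Sum>k\<le>j. a k * w k * h ^ k) = a 0" for h
  proof -
    have "(\<Sum>k\<le>j. a k * w k * h ^ k) = (\<Sum>k\<in>{0}. a k * w k * h ^ k)"
      by (rule sum.mono_neutral_right) (use False in auto)
    then show ?thesis
      using assms(2) by simp
  qed
  then show ?thesis
    by simp
next
  case True
  define m where "m = (LEAST m. 0 < m \<and> m \<le> j \<and> a m \<noteq> 0)"
  have m: "0 < m" "m \<le> j" "a m \<noteq> 0"
    using LeastI_ex[OF True] by (auto simp: m_def)
  have below_m: "a k = 0" if "0 < k" "k < m" for k
    using not_less_Least[of k "\<lambda>m. 0 < m \<and> m \<le> j \<and> a m \<noteq> 0"] that m(2) by (auto simp: m_def)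
  define R where "R N v h = (\<Sum>k=m..N. a k * v k * h ^ (k - m))" for N :: nat and v and h :: real
  have split: "(\<Sum>k\<le>N. a k * v k * h ^ k) = a 0 + h ^ m * R N v h"
    if "m \<le> N" "v 0 = 1" for N v and h :: real
  proof -
    have "(\<Sum>k\<le>N. a k * v k * h ^ k) = (\<Sum>k\<in>insert 0 {m..N}. a k * v k * h ^ k)"
      by (rule sum.mono_neutral_right) (use below_m that in \<open>auto simp: not_le\<close>)
    also have "\<dots> = a 0 + (\<Sum>k=m..N. a k * v k * h ^ k)"
      using m(1) that(2) by simp
    also have "(\<Sum>k=m..N. a k * v k * h ^ k) = h ^ m * R N v h"
      unfolding R_def sum_distrib_left
      by (intro sum.cong refl) (auto simp: power_add[symmetric] mult_ac)
    finally show ?thesis .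
  qed
  have R0: "R N v 0 = a m * v m" if "m \<le> N" for N v
  proof -
    have "R N v 0 = (\<Sum>k\<in>{m}. a k * v k * 0 ^ (k - m))"
      unfolding R_def by (rule sum.mono_neutral_right) (use that in auto)
    then show ?thesis by simp
  qed
  \<comment> \<open>\<open>B\<close> lies between \<open>a 0\<close> and \<open>A\<close> iff \<open>(B - a 0) * (A - B) \<ge> 0\<close>; this product is
     \<open>h ^ (2 * m)\<close> times \<open>G h\<close>.\<close>
  define G where "G h = R j w h * (R n (\<lambda>_. 1) h - R j w h)" for h
  have "G 0 = (a m)\<^sup>2 * (w m * (1 - w m))"
    using m(2) assms(1) by (simp add: G_def R0 power2_eq_square algebra_simps)
  also have "\<dots> > 0"
    using w[OF m(1,2)] m(3) by simp
  finally have "0 < G 0" .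
  moreover have "isCont G 0"
    unfolding G_def R_def by (intro continuous_intros)
  ultimately have "\<forall>\<^sub>F h in nhds 0. 0 < G h"
    by (metis isCont_def order_tendstoD(1) tendsto_at_iff_tendsto_nhds)
  then show ?thesis
  proof eventually_elim
    fix h assume G: "0 < G h"
    let ?x = "h ^ m * R j w h" and ?y = "h ^ m * R n (\<lambda>_. 1) h"
    have A: "(\<Sum>k\<le>n. a k * h ^ k) = a 0 + ?y"
      using split[of n "\<lambda>_. 1" h] m(2) assms(1) by simp
    have B: "(\<Sum>k\<le>j. a k * w k * h ^ k) = a 0 + ?x"
      using split[of j w h] m(2) assms(2) by simp
    have "?x * (?y - ?x) = (h ^ m)\<^sup>2 * G h"
      by (simp add: G_def power2_eq_square algebra_simps)
    then have "0 \<le> ?x * (?y - ?x)"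
      using G by simp
    moreover have "x \<in> closed_segment 0 y" if "0 \<le> x * (y - x)" for x y :: real
      using that by (auto simp: closed_segment_eq_real_ivl zero_le_mult_iff)
    ultimately have "?x \<in> closed_segment 0 ?y"
      by blast
    then show "(\<Sum>k\<le>j. a k * w k * h ^ k) \<in> closed_segment (a 0) (\<Sum>k\<le>n. a k * h ^ k)"
      unfolding A B by (auto simp: closed_segment_eq_real_ivl split: if_splits)
  qed
qed

lemma eventually_coeffs_between_end_values:
  fixes p :: "real poly"
  assumes "degree p \<le> n"
  shows "\<forall>\<^sub>F h in nhds 0. \<forall>j\<le>n.
    bernstein_coeff_on n p c (c + h) j \<in> closed_segment (poly p c) (poly p (c + h))"
proof -
  let ?a = "coeff (pcompose p [:c, 1:])"
  have ends: "?a 0 = poly p c" "(\<Sum>k\<le>n. ?a k * h ^ k) = poly p (c + h)" for h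
  proof -
    show "?a 0 = poly p c"
      by (simp add: coeff_pcompose_0)
    have "(\<Sum>k\<le>n. ?a k * h ^ k) = bernstein_coeff_on n p c (c + h) n"
      unfolding bernstein_coeff_on_eq_taylor_sum[OF assms order_refl]
      by (intro sum.cong refl) simp
    then show "(\<Sum>k\<le>n. ?a k * h ^ k) = poly p (c + h)"
      by (simp add: bernstein_coeff_on_last[OF assms])
  qed
  have "\<forall>\<^sub>F h in nhds 0.
      bernstein_coeff_on n p c (c + h) j \<in> closed_segment (poly p c) (poly p (c + h))"
    if "j \<in> {..n}" for j
  proof (cases "j = n")
    case True
    then show ?thesis
      by (simp add: bernstein_coeff_on_last[OF assms])
  next
    case False
    with that have "j \<le> n" "j < n"
      by auto
    then show ?thesis
      using eventually_shrunk_truncation_between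
          [of j n "\<lambda>k. real (j choose k) / real (n choose k)" ?a]
        binomial_ratio_strictly_between
      by (simp add: ends bernstein_coeff_on_eq_taylor_sum[OF assms])
  qed
  then have "\<forall>\<^sub>F h in nhds 0. \<forall>j\<in>{..n}.
      bernstein_coeff_on n p c (c + h) j \<in> closed_segment (poly p c) (poly p (c + h))"
    by (intro eventually_ball_finite) auto
  then show ?thesis
    by (simp only: Ball_def atMost_iff)
qed

lemma tightly_bounded_near_point:
  fixes p :: "real poly"
  assumes "degree p \<le> n"
  shows "\<exists>d>0. \<forall>h. 0 < h \<and> h < d \<longrightarrow>
    tightly_bounded n p c (c + h) \<and> tightly_bounded n p (c - h) c"
proof -
  obtain d where "0 < d" and d: "\<And>h j. \<bar>h\<bar> < d \<Longrightarrow> j \<le> n \<Longrightarrow>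
      bernstein_coeff_on n p c (c + h) j \<in> closed_segment (poly p c) (poly p (c + h))"
    using eventually_coeffs_between_end_values[OF assms, of c]
    unfolding eventually_nhds_metric by (auto simp: dist_real_def)
  have "tightly_bounded n p c (c + h)" "tightly_bounded n p (c - h) c"
    if "0 < h" "h < d" for h
  proof -
    show "tightly_bounded n p c (c + h)"
      using assms that d by (intro tightly_bounded_if_coeffs_between_end_values) auto
    have "bernstein_coeff_on n p (c - h) c j \<in> closed_segment (poly p (c - h)) (poly p c)"
      if "j \<le> n" for j
      using d[of "- h" "n - j"] \<open>0 < h\<close> \<open>h < d\<close> bernstein_coeff_on_swap[OF assms that, of "c - h" c]
      by (simp add: closed_segment_commute)
    then show "tightly_bounded n p (c - h) c"
      using assms that by (intro tightly_bounded_if_coeffs_between_end_values) auto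
  qed
  with \<open>0 < d\<close> show ?thesis
    by blast
qed

section \<open>Partitions from a local property\<close>

text \<open>Partitions of \<open>[a, b]\<close> into \<open>Q\<close>-intervals are chains from \<open>a\<close> to \<open>b\<close> in the relation
  \<open>x < y \<and> Q x y\<close>, so their existence is a statement about its reflexive transitive closure.
  Transitivity is then immediate, and Bolzano's principle leaves only intervals that are
  short relative to one of their points.\<close>

lemma partition_if_locally_on_one_sided_intervals:
  fixes Q :: "real \<Rightarrow> real \<Rightarrow> bool"
  assumes "a \<le> b"
    and loc: "\<And>x. \<exists>d>0. \<forall>h. 0 < h \<and> h < d \<longrightarrow> Q x (x + h) \<and> Q (x - h) x"
  shows "\<exists>(N::nat) s. s 0 = a \<and> s N = b \<and> strict_mono_on {0..N} s \<and>
    (\<forall>i\<in>{1..N}. Q (s (i - 1)) (s i))"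
proof -
  define R where "R x y \<longleftrightarrow> x < y \<and> Q x y" for x y
  have "R\<^sup>*\<^sup>* a b"
    using \<open>a \<le> b\<close>
  proof (induction rule: Bolzano)
    case (trans a b c)
    then show ?case
      by simp
  next
    case (local x)
    obtain d where "0 < d"
      and d: "\<And>h. 0 < h \<Longrightarrow> h < d \<Longrightarrow> Q x (x + h) \<and> Q (x - h) x"
      using loc by blast
    have "R\<^sup>*\<^sup>* a b" if "a \<le> x" "x \<le> b" "b - a < d" for a b
    proof -
      have "R\<^sup>*\<^sup>* a x"
        using d[of "x - a"] that by (cases "a = x") (auto simp: R_def)
      moreover have "R\<^sup>*\<^sup>* x b"
        using d[of "b - x"] that by (cases "x = b") (auto simp: R_def)
      ultimately show ?thesis
        by simp
    qed
    with \<open>0 < d\<close> show ?case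
      by blast
  qed
  then obtain N s where s: "s 0 = a" "s N = b" "\<And>i. i < N \<Longrightarrow> R (s i) (s (Suc i))"
    unfolding rtranclp_power relpowp_fun_conv by blast
  have "s i < s j" if "i < j" "j \<le> N" for i j
    using that
  proof (induction j)
    case (Suc j)
    then show ?case
      using s(3)[of j] by (cases "i = j") (auto simp: R_def)
  qed simp
  then have "strict_mono_on {0..N} s"
    by (auto intro: strict_mono_onI)
  moreover have "Q (s (i - 1)) (s i)" if "i \<in> {1..N}" for i
    using s(3)[of "i - 1"] that by (auto simp: R_def)
  ultimately show ?thesis
    using s(1,2) by blast
qed

theorem theorem1:
  fixes p :: "real poly" and n\<^sub>p :: nat and t\<^sub>a t\<^sub>b :: real
  assumes "degree p \<le> n\<^sub>p"
    and "t\<^sub>a < t\<^sub>b"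
    and "mono_on {t\<^sub>a..t\<^sub>b} (poly p) \<or> antimono_on {t\<^sub>a..t\<^sub>b} (poly p)"
  shows "\<exists>(N::nat) (s::nat \<Rightarrow> real).
           s 0 = t\<^sub>a \<and> s N = t\<^sub>b \<and> strict_mono_on {0..N} s \<and>
           (\<forall>i\<in>{1..N}. tightly_bounded n\<^sub>p p (s (i - 1)) (s i))"
  using assms(2) tightly_bounded_near_point[OF assms(1)]
  by (intro partition_if_locally_on_one_sided_intervals) auto

end
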